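(* Let $X$ be an order complete vector lattice and let $(E_n)_{n\ge1}$ be an abstract bistochastic filtration on $X$, with a weak unit $x_0>0$ and a strictly positive order continuous functional $x_0^*>0$ satisfying $E_1x_0=x_0$ and $x_0^*\circ E_1=x_0^*$. Let $(z_n)$ be a submartingale relative to $(E_n)$. If $\sup_n x_0^*(z_n^+)<\infty$, then $(z_n)$ is uo-Cauchy. In particular, if $(z_n)$ is order bounded, then $(z_n)$ is order convergent.
   Context: A vector lattice is order complete if every subset that is order bounded above has a supremum. A vector $x_0>0$ is a weak unit if $x\wedge nx_0\uparrow x$ for all $x\ge 0$. A positive functional is strictly positive if it does not vanish on non-zero positive vectors, and order continuous if it maps order null nets to order null nets. A filtration $(E_n)$ on $X$ is a sequence of positive (linear) projections on $X$ with $E_nE_m=E_mE_n=E_{\min(m,n)}$ for all $m,n\ge 1$. It is abstract bistochastic if there exist a weak unit $x_0>0$ and a strictly positive order continuous functional $x_0^*>0$ on $X$ with $E_1x_0=x_0$ and $E_1^*x_0^*=x_0^*$ (i.e. $x_0^*\circ E_1=x_0^*$); the same identities then hold for all $E_n$. A sequence $(z_n)\subset X$ is a submartingale relative to $(E_n)$ if $z_n\in\mathrm{Range}(E_n)$ and $E_nz_m\ge z_n$ for all $m\ge n$. A net $(x_\alpha)$ order converges to $x$ ($x_\alpha\xrightarrow{o}x$) if there is a net $(y_\beta)$ (possibly over a different index set) with $y_\beta\downarrow 0$ such that for every $\beta$ there is $\alpha_0$ with $|x_\alpha-x|\le y_\beta$ for all $\alpha\ge\alpha_0$; it uo-converges to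 $x$ if $|x_\alpha-x|\wedge y\xrightarrow{o}0$ for all $y\in X_+$. A sequence $(z_n)$ is uo-Cauchy if the double-indexed net $(z_n-z_m)_{(n,m)}$ uo-converges to $0$. *)

theory Defs
  imports Complex_Main "HOL-Library.Lattice_Algebras" "HOL-Library.Lub_Glb"
begin

class vector_lattice = ordered_real_vector + lattice_ab_group_add_abs

instance real :: vector_lattice
  by standard (simp add: sup_real_def abs_if)

text \<open>
  As usual, order completeness concerns the nonempty subsets that are bounded above: a supremum
  of the empty set would be a least element, and a nonzero vector lattice has none.
\<close>

class order_complete_vector_lattice = vector_lattice + conditionally_complete_lattice

instance real :: order_complete_vector_lattice ..


definition directed_index :: "'i set \<Rightarrow> ('i \<Rightarrow> 'i \<Rightarrow> bool) \<Rightarrow> bool" where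
  "directed_index A le \<longleftrightarrow>
     A \<noteq> {} \<and> reflp_on A le \<and> transp_on A le \<and>
     (\<forall>a\<in>A. \<forall>b\<in>A. \<exists>c\<in>A. le a c \<and> le b c)"

definition net_increases_to ::
    "'i set \<Rightarrow> ('i \<Rightarrow> 'i \<Rightarrow> bool) \<Rightarrow> ('i \<Rightarrow> 'a::order) \<Rightarrow> 'a \<Rightarrow> bool" where
  "net_increases_to A le x l \<longleftrightarrow>
     directed_index A le \<and> (\<forall>a\<in>A. \<forall>b\<in>A. le a b \<longrightarrow> x a \<le> x b) \<and> isLub UNIV (x ` A) l"

definition net_decreases_to ::
    "'i set \<Rightarrow> ('i \<Rightarrow> 'i \<Rightarrow> bool) \<Rightarrow> ('i \<Rightarrow> 'a::order) \<Rightarrow> 'a \<Rightarrow> bool" where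
  "net_decreases_to A le x l \<longleftrightarrow>
     directed_index A le \<and> (\<forall>a\<in>A. \<forall>b\<in>A. le a b \<longrightarrow> x b \<le> x a) \<and> isGlb UNIV (x ` A) l"

text \<open>
  The dominating net may have any index set, but a definition cannot quantify over types. Subsets
  of \<open>'a\<close> suffice as index sets, because a decreasing net may be replaced by its range; the lemma
  \<open>order_convergesI\<close> below allows any index type.
\<close>

definition order_converges ::
    "'i set \<Rightarrow> ('i \<Rightarrow> 'i \<Rightarrow> bool) \<Rightarrow> ('i \<Rightarrow> 'a::vector_lattice) \<Rightarrow> 'a \<Rightarrow> bool" where
  "order_converges A le x l \<longleftrightarrow>
     directed_index A le \<and>
     (\<exists>(B :: 'a set) leB (y :: 'a \<Rightarrow> 'a). net_decreases_to B leB y 0 \<and>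
        (\<forall>b\<in>B. \<exists>a0\<in>A. \<forall>a\<in>A. le a0 a \<longrightarrow> \<bar>x a - l\<bar> \<le> y b))"

lemma order_convergesI:
  fixes B :: "'j set" and x :: "'i \<Rightarrow> 'a::vector_lattice"
  assumes A: "directed_index A le" and y: "net_decreases_to B leB y 0"
    and dom: "\<And>b. b \<in> B \<Longrightarrow> \<exists>a0\<in>A. \<forall>a\<in>A. le a0 a \<longrightarrow> \<bar>x a - l\<bar> \<le> y b"
  shows "order_converges A le x l"
proof -
  have "\<exists>c\<in>y ` B. c \<le> u \<and> c \<le> v" if "u \<in> y ` B" "v \<in> y ` B" for u v
    using that y unfolding net_decreases_to_def directed_index_def by (metis imageE image_eqI)
  then have "net_decreases_to (y ` B) (\<ge>) (\<lambda>u. u) 0"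
    using y unfolding net_decreases_to_def directed_index_def
    by (auto simp: reflp_on_def transp_on_def)
  moreover have "\<forall>u\<in>y ` B. \<exists>a0\<in>A. \<forall>a\<in>A. le a0 a \<longrightarrow> \<bar>x a - l\<bar> \<le> u"
    using dom by auto
  ultimately show ?thesis
    unfolding order_converges_def using A by blast
qed

definition uo_converges ::
    "'i set \<Rightarrow> ('i \<Rightarrow> 'i \<Rightarrow> bool) \<Rightarrow> ('i \<Rightarrow> 'a::vector_lattice) \<Rightarrow> 'a \<Rightarrow> bool" where
  "uo_converges A le x l \<longleftrightarrow> (\<forall>y\<ge>0. order_converges A le (\<lambda>a. inf \<bar>x a - l\<bar> y) 0)"


text \<open>Sequences are indexed by \<open>n \<ge> 1\<close>; values at index \<open>0\<close> are never used.\<close>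

definition uo_Cauchy :: "(nat \<Rightarrow> 'a::vector_lattice) \<Rightarrow> bool" where
  "uo_Cauchy z \<longleftrightarrow>
     uo_converges ({1..} \<times> {1..}) (\<lambda>p q. fst p \<le> fst q \<and> snd p \<le> snd q)
       (\<lambda>(n, m). z n - z m) 0"

definition weak_unit :: "'a::vector_lattice \<Rightarrow> bool" where
  "weak_unit e \<longleftrightarrow>
     e > 0 \<and> (\<forall>x\<ge>0. net_increases_to {1::nat..} (\<le>) (\<lambda>n. inf x (real n *\<^sub>R e)) x)"

definition positive_linear :: "('a::vector_lattice \<Rightarrow> 'b::vector_lattice) \<Rightarrow> bool" where
  "positive_linear T \<longleftrightarrow> linear T \<and> (\<forall>x\<ge>0. T x \<ge> 0)"

definition strictly_positive :: "('a::vector_lattice \<Rightarrow> real) \<Rightarrow> bool" where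
  "strictly_positive f \<longleftrightarrow> positive_linear f \<and> (\<forall>x\<ge>0. x \<noteq> 0 \<longrightarrow> f x \<noteq> 0)"

text \<open>
  Again the index sets are subsets of \<open>'a\<close>. For a positive functional this loses nothing: see
  the lemma \<open>order_continuousD\<close>.
\<close>

definition order_continuous :: "('a::vector_lattice \<Rightarrow> real) \<Rightarrow> bool" where
  "order_continuous f \<longleftrightarrow>
     (\<forall>(A :: 'a set) le x. order_converges A le x 0 \<longrightarrow> order_converges A le (\<lambda>a. f (x a)) 0)"

lemma order_continuousD:
  fixes A :: "'i set" and x :: "'i \<Rightarrow> 'a::vector_lattice"
  assumes pos: "positive_linear f" and cont: "order_continuous f"
    and x: "order_converges A le x 0"
  shows "order_converges A le (\<lambda>a. f (x a)) 0"
proof -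
  have lin: "linear f" and nonneg: "\<And>v. v \<ge> 0 \<Longrightarrow> f v \<ge> 0"
    using pos by (auto simp: positive_linear_def)
  have mono: "f u \<le> f v" if "u \<le> v" for u v
    using nonneg[of "v - u"] that by (simp add: linear_diff[OF lin])
  have abs_le: "\<bar>f v\<bar> \<le> f \<bar>v\<bar>" for v
    using mono[of v "\<bar>v\<bar>"] mono[of "- v" "\<bar>v\<bar>"]
    by (simp add: linear_neg[OF lin] abs_ge_self abs_ge_minus_self abs_le_iff)
  have A: "directed_index A le"
    using x by (simp add: order_converges_def)
  obtain B :: "'a set" and leB and y :: "'a \<Rightarrow> 'a" where y: "net_decreases_to B leB y 0"
    and dom: "\<And>b. b \<in> B \<Longrightarrow> \<exists>a0\<in>A. \<forall>a\<in>A. le a0 a \<longrightarrow> \<bar>x a\<bar> \<le> y b"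
    using x by (auto simp: order_converges_def)
  have B: "directed_index B leB" and anti: "\<And>b c. b \<in> B \<Longrightarrow> c \<in> B \<Longrightarrow> leB b c \<Longrightarrow> y c \<le> y b"
    using y by (auto simp: net_decreases_to_def)
  have y_nonneg: "0 \<le> y b" if "b \<in> B" for b
    using y that
    by (auto simp: net_decreases_to_def isGlb_def greatestP_def isLb_def setge_def)
  have "order_converges B leB y 0"
  proof (rule order_convergesI[OF B y])
    show "\<exists>a0\<in>B. \<forall>a\<in>B. leB a0 a \<longrightarrow> \<bar>y a - 0\<bar> \<le> y b" if "b \<in> B" for b
      using that y_nonneg anti by (auto intro!: bexI[of _ b])
  qed
  then have "order_converges B leB (\<lambda>b. f (y b)) 0"
    using cont by (simp add: order_continuous_def)
  then obtain C :: "real set" and leC w where w: "net_decreases_to C leC w 0"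
    and domw: "\<And>c. c \<in> C \<Longrightarrow> \<exists>b0\<in>B. \<forall>b\<in>B. leB b0 b \<longrightarrow> \<bar>f (y b)\<bar> \<le> w c"
    by (auto simp: order_converges_def)
  show ?thesis
  proof (rule order_convergesI[OF A w])
    fix c assume "c \<in> C"
    then obtain b where b: "b \<in> B" "\<bar>f (y b)\<bar> \<le> w c"
      using domw B unfolding directed_index_def reflp_on_def by meson
    obtain a0 where a0: "a0 \<in> A" "\<And>a. a \<in> A \<Longrightarrow> le a0 a \<Longrightarrow> \<bar>x a\<bar> \<le> y b"
      using dom[OF b(1)] by blast
    have "\<bar>f (x a) - 0\<bar> \<le> w c" if "a \<in> A" "le a0 a" for a
      using abs_le[of "x a"] mono[OF a0(2)[OF that]] b(2) by linarith
    then show "\<exists>a0\<in>A. \<forall>a\<in>A. le a0 a \<longrightarrow> \<bar>f (x a) - 0\<bar> \<le> w c"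
      using a0(1) by blast
  qed
qed


definition filtration :: "(nat \<Rightarrow> 'a::vector_lattice \<Rightarrow> 'a) \<Rightarrow> bool" where
  "filtration E \<longleftrightarrow>
     (\<forall>n\<ge>1. positive_linear (E n) \<and> E n \<circ> E n = E n) \<and>
     (\<forall>n\<ge>1. \<forall>m\<ge>1. E n \<circ> E m = E (min m n) \<and> E m \<circ> E n = E (min m n))"

definition abstract_bistochastic ::
    "(nat \<Rightarrow> 'a::vector_lattice \<Rightarrow> 'a) \<Rightarrow> 'a \<Rightarrow> ('a \<Rightarrow> real) \<Rightarrow> bool" where
  "abstract_bistochastic E e f \<longleftrightarrow>
     filtration E \<and> weak_unit e \<and>
     strictly_positive f \<and> order_continuous f \<and> f \<noteq> (\<lambda>_. 0) \<and>
     E 1 e = e \<and> f \<circ> E 1 = f"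

definition submartingale ::
    "(nat \<Rightarrow> 'a::vector_lattice \<Rightarrow> 'a) \<Rightarrow> (nat \<Rightarrow> 'a) \<Rightarrow> bool" where
  "submartingale E z \<longleftrightarrow>
     (\<forall>n\<ge>1. z n \<in> range (E n)) \<and> (\<forall>n\<ge>1. \<forall>m\<ge>n. E n (z m) \<ge> z n)"

end

theory Submission
  imports Defs
begin

text \<open>
  The argument has two halves, both based on one maximal inequality.

  Truncate \<open>z\<close> to the order interval between \<open>- c *\<^sub>R x0\<close> and \<open>c *\<^sub>R x0\<close>. The truncation is a
  difference \<open>u = v - v'\<close> of two submartingales with bounded values under \<open>x0'\<close>. From a late
  time \<open>k\<close> up to any \<open>N\<close>, it is dominated by the supermartingale \<open>E j (v N) - v' j\<close>, whose value
  under \<open>x0'\<close> at time \<open>k\<close> is \<open>x0' (v N) - x0' (v' k)\<close>, nearly \<open>x0' (u k)\<close>. A process that is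
  bounded by \<open>c *\<^sub>R x0\<close> and almost surely climbs nearly to its limit superior forces, by the
  maximal inequality, a dominating supermartingale to start about that high. Hence \<open>x0'\<close> at the
  limit superior is at most the lower limit of \<open>x0' (u k)\<close>. The same holds for \<open>- u\<close>, so the
  limits superior and inferior of \<open>u\<close> have the same value under \<open>x0'\<close>, and by strict positivity
  they coincide (\<open>limsup_f_le\<close>, \<open>order_bounded_oscillation\<close>).

  The truncation error is controlled by applying the maximal inequality to a supermartingale that
  dominates \<open>\<bar>z\<bar>\<close>: the functional \<open>x0'\<close> of the error, cut at \<open>x0\<close>, is at most of order \<open>1 / c\<close>
  (\<open>tail_bound\<close>). Together the two bounds show that the tail oscillations of \<open>z\<close>, cut at the
  weak unit, decrease to \<open>0\<close> (\<open>vanishing_oscillation\<close>).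

  The classical maximal inequality integrates the indicator of an event. In the vector lattice its
  place is taken by a lattice expression, the sum of the excesses over the level cut at the unit,
  which admits the same bounds by backward induction (\<open>maximal_inequality\<close>).
\<close>

section \<open>Vector lattices\<close>

lemma inf_pprt_pprt_neg:
  fixes x :: "'a::vector_lattice"
  shows "inf (pprt x) (pprt (- x)) = 0"
proof -
  have "inf (pprt x) (pprt (- x)) + nprt x = inf (pprt x + nprt x) (- nprt x + nprt x)"
    by (simp only: add_inf_distrib_right pprt_neg)
  also have "\<dots> = inf x 0"
    by (simp only: prts[symmetric] left_minus)
  also have "\<dots> = nprt x"
    by (simp only: nprt_def)
  finally show ?thesis by (simp only: add_cancel_left_left)
qed

lemma scaleR_inf:
  fixes x y :: "'a::vector_lattice"
  assumes "0 < k"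
  shows "k *\<^sub>R inf x y = inf (k *\<^sub>R x) (k *\<^sub>R y)"
proof (rule antisym)
  show "k *\<^sub>R inf x y \<le> inf (k *\<^sub>R x) (k *\<^sub>R y)"
    using assms by (simp add: scaleR_left_mono)
  have "inverse k *\<^sub>R inf (k *\<^sub>R x) (k *\<^sub>R y) \<le> inf x y"
    using assms scaleR_left_mono[of "inf (k *\<^sub>R x) (k *\<^sub>R y)" "k *\<^sub>R x" "inverse k"]
      scaleR_left_mono[of "inf (k *\<^sub>R x) (k *\<^sub>R y)" "k *\<^sub>R y" "inverse k"] by simp
  from scaleR_left_mono[OF this, of k] show "inf (k *\<^sub>R x) (k *\<^sub>R y) \<le> k *\<^sub>R inf x y"
    using assms by simp
qed

lemma inf_scaleR_eq_0:
  fixes x y :: "'a::vector_lattice"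
  assumes "inf x y = 0" "0 \<le> k"
  shows "inf (k *\<^sub>R x) y = 0"
proof (rule antisym)
  have nonneg: "0 \<le> x" "0 \<le> y"
    using assms(1) inf_le1[of x y] inf_le2[of x y] by simp_all
  then show "0 \<le> inf (k *\<^sub>R x) y"
    using assms(2) by (simp add: scaleR_nonneg_nonneg)
  have "inf (k *\<^sub>R x) y \<le> inf ((k + 1) *\<^sub>R x) ((k + 1) *\<^sub>R y)"
    using nonneg assms(2) scaleR_nonneg_nonneg[of k y]
    by (intro inf_mono) (simp_all add: scaleR_left_distrib add_increasing2)
  also have "\<dots> = 0"
    using scaleR_inf[of "k + 1" x y] assms by simp
  finally show "inf (k *\<^sub>R x) y \<le> 0" .
qed

lemma inf_add_le_inf_add_inf:
  fixes x y z :: "'a::vector_lattice"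
  assumes "0 \<le> x" "0 \<le> y" "0 \<le> z"
  shows "inf (x + y) z \<le> inf x z + inf y z"
proof -
  have "inf (x + y) z \<le> x + y" "inf (x + y) z \<le> x + z" "inf (x + y) z \<le> z + y" 
    "inf (x + y) z \<le> z + z"
    using assms by (simp_all add: le_infI1 le_infI2 add_increasing add_increasing2)
  then show ?thesis
    by (simp add: add_inf_distrib_right add_inf_distrib_left)
qed

text \<open>
  Pointwise, the left-hand side could exceed \<open>w\<close> only where \<open>p > 0\<close> and \<open>a > w\<close>; but \<open>p > 0\<close>
  forces \<open>w > a\<close>. The disjointness of the positive parts of \<open>w - a\<close> and \<open>a - w\<close> expresses this in
  a vector lattice. The inequality is the induction step of the maximal inequality.
\<close>

lemma inf_overshoot_le:
  fixes w p a :: "'a::vector_lattice"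
  assumes "0 \<le> k" "p \<le> pprt (w - a)"
  shows "inf (k *\<^sub>R p + w) a \<le> w"
proof -
  have "inf (k *\<^sub>R p + w) a - w = inf (k *\<^sub>R p) (a - w)"
    by (simp add: add_inf_distrib_right diff_conv_add_uminus del: add_uminus_conv_diff)
  also have "\<dots> \<le> inf (k *\<^sub>R pprt (w - a)) (pprt (a - w))"
    using assms by (intro inf_mono scaleR_left_mono) (simp_all add: pprt_def)
  also have "\<dots> = 0"
    using inf_scaleR_eq_0[OF inf_pprt_pprt_neg assms(1), of "w - a"] by simp
  finally show ?thesis by simp
qed

lemma pprt_diff_eq:
  fixes x y :: "'a::vector_lattice"
  shows "pprt (y - x) = y - inf x y"
proof -
  have "y - inf x y = y + sup (- x) (- y)"
    by (rule diff_inf_eq_sup)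
  also have "\<dots> = sup (y + (- x)) (y + (- y))"
    by (rule add_sup_distrib_left)
  also have "\<dots> = pprt (y - x)"
    by (simp only: pprt_def right_minus diff_conv_add_uminus)
  finally show ?thesis ..
qed

lemma pprt_add_le:
  fixes x y :: "'a::vector_lattice"
  shows "pprt (x + y) \<le> pprt x + pprt y"
proof -
  have "x + y \<le> pprt x + pprt y"
    by (intro add_mono) (simp_all add: pprt_def)
  moreover have "0 \<le> pprt x + pprt y"
    by (intro add_nonneg_nonneg zero_le_pprt)
  ultimately show ?thesis
    unfolding pprt_def by (rule sup_least)
qed

text \<open>
  The element \<open>y\<close> is \<open>x\<close> truncated to the order interval \<open>[-h, h]\<close>. It is written as a difference
  of two convex increasing functions of \<open>x\<close>, so that truncating a submartingale yields a
  difference of two submartingales.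
\<close>

lemma clamp_bounds:
  fixes x h :: "'a::vector_lattice"
  assumes "0 \<le> h"
  defines "y \<equiv> pprt (x + h) - (pprt (x - h) + h)"
  shows "- h \<le> y" "y \<le> h" "\<bar>x - y\<bar> \<le> pprt (\<bar>x\<bar> - h)"
proof -
  have "x - h \<le> x + h"
    using assms(1) by (simp add: diff_le_eq add.assoc add_increasing2)
  then have "pprt (x - h) \<le> pprt (x + h)" by (rule pprt_mono)
  then have "pprt (x - h) - (pprt (x - h) + h) \<le> y"
    unfolding y_def by (rule diff_right_mono)
  then show "- h \<le> y" by simp
  have "pprt (x + h) \<le> pprt (x - h) + (h + h)"
    using pprt_add_le[of "x - h" "h + h"] assms(1) by (simp add: add_nonneg_nonneg)
  then have "y \<le> pprt (x - h) + (h + h) - (pprt (x - h) + h)"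
    unfolding y_def by (rule diff_right_mono)
  then show "y \<le> h" by simp
  have "x - y = (pprt (x + h) + nprt (x + h)) - h - y"
    by (simp only: prts[symmetric] add_diff_cancel_right')
  also have "\<dots> = pprt (x - h) - pprt (- x - h)"
    using pprt_neg[of "x + h"] by (simp add: y_def)
  finally have *: "x - y = pprt (x - h) - pprt (- x - h)" .
  have p: "pprt (x - h) \<le> pprt (\<bar>x\<bar> - h)" and m: "pprt (- x - h) \<le> pprt (\<bar>x\<bar> - h)"
    by (intro pprt_mono diff_right_mono abs_ge_self abs_ge_minus_self)+
  show "\<bar>x - y\<bar> \<le> pprt (\<bar>x\<bar> - h)"
    unfolding *
  proof (rule abs_leI)
    show "pprt (x - h) - pprt (- x - h) \<le> pprt (\<bar>x\<bar> - h)"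
      using add_mono[OF p zero_le_pprt[of "- x - h"]] by (simp only: diff_le_eq add_0_right)
    show "- (pprt (x - h) - pprt (- x - h)) \<le> pprt (\<bar>x\<bar> - h)"
      using add_mono[OF m zero_le_pprt[of "x - h"]] by (simp only: minus_diff_eq diff_le_eq add_0_right)
  qed
qed

text \<open>
  This is the infinite distributive law, valid for existing suprema in every vector lattice: the identity
  \<open>x + y = sup x y + inf x y\<close> turns the bound on each \<open>inf (g i) y\<close> into an upper bound of
  \<open>g i\<close> itself.
\<close>

lemma inf_cSUP_le:
  fixes g :: "'i \<Rightarrow> 'a::order_complete_vector_lattice"
  assumes "A \<noteq> {}" "bdd_above (g ` A)" "\<And>i. i \<in> A \<Longrightarrow> inf (g i) y \<le> b"
  shows "inf (SUP i\<in>A. g i) y \<le> b"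
proof -
  let ?s = "SUP i\<in>A. g i"
  have "g i \<le> b + sup ?s y - y" if "i \<in> A" for i
  proof -
    have "g i + y = sup (g i) y + inf (g i) y"
      by (rule add_eq_inf_sup)
    also have "\<dots> \<le> sup ?s y + b"
      using assms that by (intro add_mono sup_mono cSUP_upper) auto
    finally show ?thesis by (simp add: algebra_simps)
  qed
  then have "?s \<le> b + sup ?s y - y"
    using assms(1) by (intro cSUP_least)
  then have "?s + y \<le> b + sup ?s y" by (simp add: le_diff_eq)
  then have "sup ?s y + inf ?s y \<le> sup ?s y + b"
    by (simp only: add_eq_inf_sup[of ?s y, symmetric] add.commute[of b])
  then show ?thesis by (simp only: add_le_cancel_left)
qed

lemma le_pprt_diff_cSUP:
  fixes g :: "'i \<Rightarrow> 'a::order_complete_vector_lattice"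
  assumes "A \<noteq> {}" "bdd_above (g ` A)" "\<And>i. i \<in> A \<Longrightarrow> x \<le> pprt (y - g i)"
  shows "x \<le> pprt (y - (SUP i\<in>A. g i))"
proof -
  have "inf (g i) y \<le> y - x" if "i \<in> A" for i
    using assms(3)[OF that] by (simp only: pprt_diff_eq le_diff_eq add.commute)
  with assms(1,2) have "inf (SUP i\<in>A. g i) y \<le> y - x"
    by (rule inf_cSUP_le)
  then show ?thesis
    by (simp only: pprt_diff_eq le_diff_eq add.commute)
qed

lemma directed_index_linorder:
  fixes A :: "'i::linorder set"
  assumes "A \<noteq> {}"
  shows "directed_index A (\<le>)"
proof -
  have "\<exists>c\<in>A. a \<le> c \<and> b \<le> c" if "a \<in> A" "b \<in> A" for a b
    using that by (intro bexI[of _ "max a b"]) (auto simp: max_def)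
  with assms show ?thesis
    unfolding directed_index_def by (auto simp: reflp_on_def transp_on_def)
qed

section \<open>Bistochastic filtrations\<close>

locale bistochastic_filtration =
  fixes E :: "nat \<Rightarrow> 'a::order_complete_vector_lattice \<Rightarrow> 'a" and e :: 'a and f :: "'a \<Rightarrow> real"
  assumes bistochastic: "abstract_bistochastic E e f"
begin

lemma f_linear: "linear f" and f_positive: "positive_linear f"
  and f_nonneg: "0 \<le> x \<Longrightarrow> 0 \<le> f x"
  and f_strict: "0 \<le> x \<Longrightarrow> f x \<le> 0 \<Longrightarrow> x = 0"
  using bistochastic unfolding abstract_bistochastic_def strictly_positive_def positive_linear_def
  by (auto intro: antisym)

lemmas f_simps = linear_add[OF f_linear] linear_diff[OF f_linear] linear_neg[OF f_linear]
  linear_scale[OF f_linear] linear_0[OF f_linear]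

lemma f_mono: "x \<le> y \<Longrightarrow> f x \<le> f y"
  using f_nonneg[of "y - x"] by (simp add: f_simps)

lemma e_pos: "0 < e"
  and weak_unit: "0 \<le> x \<Longrightarrow> net_increases_to {1::nat..} (\<le>) (\<lambda>n. inf x (real n *\<^sub>R e)) x"
  using bistochastic by (auto simp: abstract_bistochastic_def weak_unit_def)

lemma f_e_pos: "0 < f e"
  using f_strict[of e] e_pos by (metis less_le not_le)

lemma E_linear: "1 \<le> n \<Longrightarrow> linear (E n)"
  and E_nonneg: "1 \<le> n \<Longrightarrow> 0 \<le> x \<Longrightarrow> 0 \<le> E n x"
  and E_E: "1 \<le> n \<Longrightarrow> n \<le> m \<Longrightarrow> E n (E m x) = E n x"
  and E_E': "1 \<le> n \<Longrightarrow> n \<le> m \<Longrightarrow> E m (E n x) = E n x"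
  using bistochastic unfolding abstract_bistochastic_def filtration_def positive_linear_def
  by (auto simp: fun_eq_iff min_def split: if_splits)

lemmas E_simps = linear_add[OF E_linear] linear_diff[OF E_linear] linear_neg[OF E_linear]
  linear_scale[OF E_linear] linear_0[OF E_linear]

lemma E_mono: "1 \<le> n \<Longrightarrow> x \<le> y \<Longrightarrow> E n x \<le> E n y"
  using E_nonneg[of n "y - x"] by (simp add: E_simps)

lemma E_e: "1 \<le> n \<Longrightarrow> E n e = e"
  using bistochastic E_E'[of 1 n e] by (simp add: abstract_bistochastic_def)

lemma f_E:
  assumes "1 \<le> n"
  shows "f (E n x) = f x"
proof -
  have *: "f (E 1 y) = f y" for y
    using bistochastic unfolding abstract_bistochastic_def by (simp add: fun_eq_iff)
  show ?thesis
    using *[of x] *[of "E n x"] E_E[OF order_refl assms] by simp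
qed

lemma E_fixed_mono: "1 \<le> n \<Longrightarrow> n \<le> m \<Longrightarrow> E n x = x \<Longrightarrow> E m x = x"
  using E_E'[of n m x] by simp

text \<open>
  Positivity gives \<open>sup x y \<le> E n (sup x y)\<close>, and since \<open>f\<close> is strictly positive and takes the
  same value on both sides, the two agree. The range of each \<open>E n\<close> is thus a sublattice.
\<close>

lemma E_fixed_sup:
  assumes "1 \<le> n" "E n x = x" "E n y = y"
  shows "E n (sup x y) = sup x y"
proof -
  have "sup x y \<le> E n (sup x y)"
    using E_mono[OF assms(1), of x "sup x y"] E_mono[OF assms(1), of y "sup x y"] assms by simp
  moreover have "f (E n (sup x y) - sup x y) \<le> 0"
    using f_E[OF assms(1)] by (simp only: linear_diff[OF f_linear])
  ultimately have "E n (sup x y) - sup x y = 0"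
    by (intro f_strict) (simp_all only: diff_ge_0_iff_ge)
  then show ?thesis by (simp only: right_minus_eq)
qed

lemma E_fixed_inf:
  assumes "1 \<le> n" "E n x = x" "E n y = y"
  shows "E n (inf x y) = inf x y"
  using E_fixed_sup[of n "- x" "- y"] assms
  by (simp only: inf_eq_neg_sup[of x y] linear_neg[OF E_linear])

lemma E_fixed_pprt: "1 \<le> n \<Longrightarrow> E n x = x \<Longrightarrow> E n (pprt x) = pprt x"
  unfolding pprt_def by (rule E_fixed_sup) (simp_all add: E_simps)

lemma E_fixed_SUP:
  assumes "1 \<le> k" "finite A" "A \<noteq> {}" "\<And>j. j \<in> A \<Longrightarrow> E k (b j) = b j"
  shows "E k (SUP j\<in>A. b j) = (SUP j\<in>A. b j)"
  using assms(2,3,4)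
proof (induction A rule: finite_ne_induct)
  case (insert j A)
  have "(SUP i\<in>insert j A. b i) = sup (b j) (SUP i\<in>A. b i)"
    using insert.hyps by (intro cSUP_insert) (auto intro: bdd_above_finite)
  then show ?case
    using insert E_fixed_sup[OF assms(1)] by simp
qed simp

text \<open>
  The differences \<open>a n - l\<close> decrease to \<open>0\<close> and dominate themselves, so they form an order null
  sequence, to which order continuity of \<open>f\<close> applies.
\<close>

lemma f_decreasing_limit:
  assumes "decseq a" and lower: "\<And>n. l \<le> a n" and greatest: "\<And>c. (\<And>n. c \<le> a n) \<Longrightarrow> c \<le> l"
  shows "(\<lambda>n. f (a n)) \<longlonglongrightarrow> f l"
proof (rule LIMSEQ_I)
  fix r :: real assume "0 < r"
  let ?b = "\<lambda>n. a n - l"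
  have dir: "directed_index (UNIV :: nat set) (\<le>)"
    by (intro directed_index_linorder) simp
  have "c \<le> 0" if "\<And>n. c \<le> a n - l" for c
  proof -
    have "c + l \<le> l" using that by (intro greatest) (simp add: le_diff_eq)
    then show ?thesis by simp
  qed
  then have "net_decreases_to (UNIV :: nat set) (\<le>) ?b 0"
    using dir lower decseqD[OF assms(1)]
    unfolding net_decreases_to_def isGlb_def greatestP_def isLb_def setge_def setle_def
    by (auto simp: diff_right_mono)
  moreover have "\<bar>?b m - 0\<bar> \<le> ?b n" if "n \<le> m" for m n
    using lower[of m] decseqD[OF assms(1) that] by (simp add: diff_right_mono)
  ultimately have "order_converges UNIV (\<le>) ?b 0"
    using dir by (intro order_convergesI[where B="UNIV :: nat set" and leB="(\<le>)" and y="?b"]) auto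
  then have "order_converges UNIV (\<le>) (\<lambda>n. f (?b n)) 0"
    using bistochastic by (intro order_continuousD[OF f_positive]) (simp_all add: abstract_bistochastic_def)
  then obtain C :: "real set" and leC w where w: "net_decreases_to C leC w 0"
    and dom: "\<And>c. c \<in> C \<Longrightarrow> \<exists>n0. \<forall>n\<ge>n0. \<bar>f (?b n)\<bar> \<le> w c"
    by (auto simp: order_converges_def)
  have "\<exists>c\<in>C. w c < r"
  proof (rule ccontr)
    assume "\<not> ?thesis"
    then have "isLb UNIV (w ` C) r"
      by (auto simp: isLb_def setge_def not_less)
    then have "r \<le> 0"
      using w by (auto simp: net_decreases_to_def isGlb_def greatestP_def setle_def)
    with \<open>0 < r\<close> show False by simp
  qed
  then obtain c where c: "c \<in> C" "w c < r" by blast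
  obtain n0 where n0: "\<And>n. n \<ge> n0 \<Longrightarrow> \<bar>f (?b n)\<bar> \<le> w c"
    using dom[OF c(1)] by blast
  then show "\<exists>n0. \<forall>n\<ge>n0. norm (f (a n) - f l) < r"
    using c(2) by (intro exI[of _ n0]) (force simp: f_simps)
qed

lemma f_INF_limit:
  assumes "decseq a" "bdd_below (range a)"
  shows "(\<lambda>n. f (a n)) \<longlonglongrightarrow> f (INF n. a n)"
  using assms by (intro f_decreasing_limit) (auto intro: cINF_lower cINF_greatest)

lemma f_SUP_finite_limit:
  fixes b :: "nat \<Rightarrow> 'a"
  assumes bdd: "bdd_above (b ` {n<..})"
  shows "(\<lambda>k. f (SUP j\<in>{n<..Suc n + k}. b j)) \<longlonglongrightarrow> f (SUP j\<in>{n<..}. b j)"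
proof -
  let ?M = "\<lambda>k. SUP j\<in>{n<..Suc n + k}. b j" and ?S = "SUP j\<in>{n<..}. b j"
  have bdd': "bdd_above (b ` {n<..m})" for m
    by (rule bdd_above_mono[OF bdd]) auto
  have M_mono: "?M k \<le> ?M k'" if "k \<le> k'" for k k'
    using that by (intro cSUP_subset_mono bdd') auto
  have M_le: "?M k \<le> ?S" for k
    by (intro cSUP_subset_mono bdd) auto
  have b_le: "b j \<le> ?M j" if "n < j" for j
    using that by (intro cSUP_upper bdd') auto
  have "(\<lambda>k. f (?S - ?M k)) \<longlonglongrightarrow> f 0"
  proof (rule f_decreasing_limit)
    show "decseq (\<lambda>k. ?S - ?M k)"
      by (rule decseq_SucI) (rule diff_left_mono[OF M_mono], simp)
    show "0 \<le> ?S - ?M k" for k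
      using M_le[of k] by (simp only: diff_ge_0_iff_ge)
    fix c assume c: "\<And>k. c \<le> ?S - ?M k"
    have "b j \<le> ?S - c" if "n < j" for j
      using b_le[OF that] c[of j] by (simp only: le_diff_eq) (metis add.commute add_right_mono order_trans)
    then have "?S \<le> ?S - c"
      by (intro cSUP_least) auto
    then show "c \<le> 0" by (simp only: le_diff_eq add_le_same_cancel1)
  qed
  then have "(\<lambda>k. f ?S - f (?S - ?M k)) \<longlonglongrightarrow> f ?S - f 0"
    by (intro tendsto_intros)
  then show ?thesis
    by (simp only: linear_diff[OF f_linear] linear_0[OF f_linear] diff_diff_eq2 diff_0_right add_diff_cancel_left')
qed

lemma submartingale_fixed: "submartingale E z \<Longrightarrow> 1 \<le> n \<Longrightarrow> E n (z n) = z n"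
  unfolding submartingale_def using E_E[of n n] by (metis order_refl rangeE)

lemma submartingale_le: "submartingale E z \<Longrightarrow> 1 \<le> n \<Longrightarrow> n \<le> m \<Longrightarrow> z n \<le> E n (z m)"
  by (simp add: submartingale_def)

lemma submartingale_f_mono: "submartingale E z \<Longrightarrow> 1 \<le> n \<Longrightarrow> n \<le> m \<Longrightarrow> f (z n) \<le> f (z m)"
  using f_mono[OF submartingale_le] by (simp add: f_E)

lemma submartingale_add_fixed:
  assumes "submartingale E z" "\<And>n. 1 \<le> n \<Longrightarrow> E n h = h"
  shows "submartingale E (\<lambda>n. z n + h)"
  unfolding submartingale_def
proof (intro conjI allI impI)
  fix n :: nat assume n: "1 \<le> n"
  show "z n + h \<in> range (E n)"
    using submartingale_fixed[OF assms(1) n] assms(2)[OF n] E_simps(1)[OF n, of "z n" h]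
    by (metis rangeI)
  fix m assume m: "n \<le> m"
  show "z n + h \<le> E n (z m + h)"
    using submartingale_le[OF assms(1) n m] assms(2)[OF n] by (simp add: E_simps(1)[OF n])
qed

lemma submartingale_pprt:
  assumes "submartingale E z"
  shows "submartingale E (\<lambda>n. pprt (z n))"
  unfolding submartingale_def
proof (intro conjI allI impI)
  fix n :: nat assume n: "1 \<le> n"
  show "pprt (z n) \<in> range (E n)"
    using E_fixed_pprt[OF n submartingale_fixed[OF assms n]] by (metis rangeI)
  fix m assume m: "n \<le> m"
  have "z n \<le> E n (pprt (z m))"
    using submartingale_le[OF assms n m] E_mono[OF n, of "z m" "pprt (z m)"]
    by (simp add: pprt_def order_trans)
  moreover have "0 \<le> E n (pprt (z m))"
    by (intro E_nonneg[OF n] zero_le_pprt)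
  ultimately show "pprt (z n) \<le> E n (pprt (z m))"
    by (simp add: pprt_def)
qed

section \<open>The maximal inequality\<close>

text \<open>
  This is the maximal inequality for nonnegative supermartingales, with \<open>T\<close> in the role of the
  indicator of the event that some \<open>W j\<close> exceeds the level \<open>k *\<^sub>R d\<close>. If \<open>b j\<close> denotes the excess of
  \<open>W j\<close> over the level, cut at \<open>d\<close>, then \<open>T = inf (b n + \<dots> + b N) d\<close> dominates every \<open>b j\<close>, and
  backward induction gives \<open>k *\<^sub>R E n T \<le> W n\<close>. In the step from \<open>T\<close> to \<open>inf (b m + T) d\<close>, the
  expectation under \<open>E m\<close> is at most \<open>inf (b m + E m T) d\<close>, and \<open>inf_overshoot_le\<close> bounds \<open>k\<close> times
  this element by \<open>W m\<close>. The unit \<open>d\<close> is a parameter because small multiples of \<open>e\<close> occur as units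
  below.
\<close>

lemma maximal_inequality:
  assumes "n \<le> N" "1 \<le> n" "0 \<le> k" "0 \<le> d"
    and d: "\<And>j. n \<le> j \<Longrightarrow> E j d = d"
    and W_nonneg: "\<And>j. n \<le> j \<Longrightarrow> j \<le> N \<Longrightarrow> 0 \<le> W j"
    and W_fixed: "\<And>j. n \<le> j \<Longrightarrow> j \<le> N \<Longrightarrow> E j (W j) = W j"
    and W_super: "\<And>j. n \<le> j \<Longrightarrow> j < N \<Longrightarrow> E j (W (Suc j)) \<le> W j"
  obtains T where "T \<le> d" "k * f T \<le> f (W n)"
    "\<And>j. n \<le> j \<Longrightarrow> j \<le> N \<Longrightarrow> inf (pprt (W j - k *\<^sub>R d)) d \<le> T"
proof -
  let ?b = "\<lambda>j. inf (pprt (W j - k *\<^sub>R d)) d"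
  have b_fixed: "E j (?b j) = ?b j" if "n \<le> j" "j \<le> N" for j
  proof -
    have "1 \<le> j" using that assms(2) by simp
    then show ?thesis
      using d[OF that(1)] W_fixed[OF that] by (intro E_fixed_inf E_fixed_pprt) (simp_all add: E_simps)
  qed
  have b_nonneg: "0 \<le> ?b j" for j
    using \<open>0 \<le> d\<close> by simp
  have "\<exists>T\<le>d. k *\<^sub>R E n T \<le> W n \<and> (\<forall>j\<in>{n..N}. ?b j \<le> T)"
    using \<open>n \<le> N\<close>
  proof (induction rule: inc_induct)
    case base
    have "k *\<^sub>R ?b N \<le> inf (k *\<^sub>R ?b N + W N) (k *\<^sub>R d)"
    proof (rule inf_greatest)
      show "k *\<^sub>R ?b N \<le> k *\<^sub>R ?b N + W N"
        using W_nonneg[of N] \<open>n \<le> N\<close> by simp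
      show "k *\<^sub>R ?b N \<le> k *\<^sub>R d"
        by (rule scaleR_left_mono[OF inf_le2 \<open>0 \<le> k\<close>])
    qed
    also have "\<dots> \<le> W N"
      by (rule inf_overshoot_le[OF \<open>0 \<le> k\<close> inf_le1])
    finally show ?case
      using b_fixed[of N] \<open>n \<le> N\<close> by (intro exI[of _ "?b N"]) auto
  next
    case (step m)
    obtain T where T: "T \<le> d" "k *\<^sub>R E (Suc m) T \<le> W (Suc m)"
      "\<And>j. j \<in> {Suc m..N} \<Longrightarrow> ?b j \<le> T"
      using step.IH by blast
    let ?T = "inf (?b m + T) d"
    have m: "1 \<le> m" using step.hyps assms(2) by simp
    have "k *\<^sub>R E m T = E m (k *\<^sub>R E (Suc m) T)"
      using m by (simp add: E_simps E_E)
    also have "\<dots> \<le> W m"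
      using E_mono[OF m T(2)] W_super[OF step.hyps] by (rule order_trans)
    finally have kT: "k *\<^sub>R E m T \<le> W m" .
    have "E m ?T \<le> ?b m + E m T"
      using E_mono[OF m, of ?T "?b m + T", OF inf_le1] b_fixed[of m] step.hyps
      by (simp only: linear_add[OF E_linear[OF m]] less_imp_le)
    then have "k *\<^sub>R E m ?T \<le> k *\<^sub>R (?b m + E m T)"
      by (rule scaleR_left_mono) fact
    also have "\<dots> \<le> k *\<^sub>R ?b m + W m"
      using kT by (simp only: scaleR_right_distrib add_left_mono)
    finally have 1: "k *\<^sub>R E m ?T \<le> k *\<^sub>R ?b m + W m" .
    have "E m ?T \<le> d"
      using E_mono[OF m, of ?T d, OF inf_le2] d[of m] step.hyps by simp
    then have "k *\<^sub>R E m ?T \<le> k *\<^sub>R d"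
      by (rule scaleR_left_mono) fact
    with 1 have "k *\<^sub>R E m ?T \<le> inf (k *\<^sub>R ?b m + W m) (k *\<^sub>R d)"
      by (rule inf_greatest)
    also have "\<dots> \<le> W m"
      by (rule inf_overshoot_le[OF \<open>0 \<le> k\<close> inf_le1])
    finally have 2: "k *\<^sub>R E m ?T \<le> W m" .
    have T_le: "T \<le> ?T"
      using T(1) add_right_mono[OF b_nonneg[of m], of T] by (simp only: le_inf_iff add_0)
    have "?b j \<le> ?T" if "j \<in> {m..N}" for j
    proof (cases "j = m")
      case True
      have "0 \<le> T"
        using T(3)[of N] b_nonneg[of N] step.hyps by (meson Suc_leI atLeastAtMost_iff order_refl order_trans)
      then show ?thesis
        using True add_left_mono[of 0 T "?b m"] by (simp only: le_inf_iff add_0_right inf_le2)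
    next
      case False
      then have "?b j \<le> T" using that by (intro T(3)) simp
      then show ?thesis using T_le by (rule order_trans)
    qed
    with 2 show ?case by (intro exI[of _ ?T]) simp
  qed
  then obtain T where T: "T \<le> d" "k *\<^sub>R E n T \<le> W n"
    "\<And>j. j \<in> {n..N} \<Longrightarrow> inf (pprt (W j - k *\<^sub>R d)) d \<le> T" by blast
  have "k * f T \<le> f (W n)"
    using f_mono[OF T(2)] f_E[OF assms(2)] by (simp add: f_simps)
  with T show thesis by (intro that) auto
qed

section \<open>Order bounded differences of submartingales\<close>

text \<open>
  Let \<open>L\<close> be the order limit superior of \<open>u\<close>. It is approximated in the norm \<open>x \<mapsto> f \<bar>x\<bar>\<close> by a finite
  supremum \<open>Y = sup {u j | n < j \<le> k}\<close>, which is fixed by \<open>E k\<close>. After time \<open>k\<close> the sequence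
  climbs nearly to \<open>L\<close> again, hence nearly to \<open>Y\<close>. Put \<open>W j = E j (v N) - v' j - Y + 2 h\<close> with
  \<open>h = c *\<^sub>R e\<close>. Since \<open>v j \<le> E j (v N)\<close>, this supermartingale dominates \<open>u j - Y + 2 h \<ge> 0\<close>, and
  outside a small set it exceeds the level \<open>2 h - \<delta> *\<^sub>R e\<close> at some time. The maximal inequality then says that
  \<open>f (W k)\<close> is at least nearly \<open>2 * c * f e\<close>, that is, \<open>f Y\<close> is at most about
  \<open>f (v N) - f (v' k)\<close>. This is about \<open>f (u k)\<close>, because the bounded increasing sequence
  \<open>f (v n)\<close> converges.
\<close>

lemma limsup_f_le:
  assumes v: "submartingale E v" and v': "submartingale E v'"
    and bounded: "\<And>n. 1 \<le> n \<Longrightarrow> f (v n) \<le> C"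
    and u: "\<And>n. u n = v n - v' n"
    and c: "0 < c" and lower: "\<And>n. 1 \<le> n \<Longrightarrow> - (c *\<^sub>R e) \<le> u n"
    and upper: "\<And>n. 1 \<le> n \<Longrightarrow> u n \<le> c *\<^sub>R e"
    and "0 < r"
  shows "\<exists>K. \<forall>k>K. f (INF n. SUP j\<in>{n<..}. u j) \<le> f (u k) + r"
proof -
  define h where "h = c *\<^sub>R e"
  \<comment> \<open>Tails start after \<open>n\<close>, so that the unspecified value \<open>u 0\<close> never enters.\<close>
  define S where "S n = (SUP j\<in>{n<..}. u j)" for n
  define M where "M n k = (SUP j\<in>{n<..k}. u j)" for n k
  define L where "L = (INF n. S n)"
  define \<delta> where "\<delta> = min c (r / (2 * f e))"
  \<comment> \<open>\<open>\<delta>\<close> and \<open>\<eta>\<close> are chosen so that the total error \<open>\<delta> * f e + 2 * \<eta> * q\<close> accumulated below is \<open>r\<close> at most.\<close>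
  define q where "q = 1 + 2 * c / \<delta>"
  define \<eta> where "\<eta> = r / (4 * q)"
  have \<delta>: "0 < \<delta>" "\<delta> \<le> c" "\<delta> * f e \<le> r / 2"
  proof -
    have "\<delta> \<le> r / (2 * f e)" by (simp add: \<delta>_def)
    then show "\<delta> * f e \<le> r / 2" using f_e_pos by (simp add: field_simps)
  qed (use \<open>0 < r\<close> c f_e_pos in \<open>simp_all add: \<delta>_def\<close>)
  have "0 < q" using \<delta> c by (simp add: q_def add_pos_pos)
  then have \<eta>: "0 < \<eta>" "2 * \<eta> * q = r / 2"
    using \<open>0 < r\<close> by (simp_all add: \<eta>_def)
  have lower': "- h \<le> u n" and upper': "u n \<le> h" if "1 \<le> n" for n
    using lower[OF that] upper[OF that] by (simp_all add: h_def)
  have bdd: "bdd_above (u ` {n<..})" for n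
    using upper' by (intro bdd_aboveI2[of _ _ h]) auto
  have bdd': "bdd_above (u ` {n<..k})" for n k
    by (rule bdd_above_mono[OF bdd[of n]]) auto
  have S_upper: "u j \<le> S n" if "n < j" for n j
    unfolding S_def using that by (intro cSUP_upper bdd) auto
  have S_anti: "S m \<le> S n" if "n \<le> m" for m n
    unfolding S_def using that by (intro cSUP_subset_mono bdd) auto
  have S_lower: "- h \<le> S n" for n
    using lower'[of "Suc n"] S_upper[of n "Suc n"] by (simp add: order_trans)
  have S_bdd: "bdd_below (range S)"
    using S_lower by (intro bdd_belowI2)
  have L_le: "L \<le> S n" for n
    unfolding L_def by (intro cINF_lower S_bdd) simp
  have M_le: "M n k \<le> S n" if "n < k" for n k
    unfolding M_def S_def using that by (intro cSUP_subset_mono bdd) auto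
  have M_upper: "M n k \<le> h" if "n < k" for n k
    unfolding M_def using that upper' by (intro cSUP_least) auto
  have M_ev: "\<exists>K. \<forall>k\<ge>K. f (S n) \<le> f (M n k) + \<eta>" for n
  proof -
    have "\<forall>\<^sub>F k in sequentially. dist (f (M n (Suc n + k))) (f (S n)) < \<eta>"
      using f_SUP_finite_limit[OF bdd] \<eta>(1) unfolding M_def S_def by (rule tendstoD)
    then obtain K where K: "\<And>k. K \<le> k \<Longrightarrow> dist (f (M n (Suc n + k))) (f (S n)) < \<eta>"
      by (auto simp: eventually_sequentially)
    have "f (S n) \<le> f (M n k) + \<eta>" if "Suc n + K \<le> k" for k
    proof -
      have "K \<le> k - Suc n" "Suc n + (k - Suc n) = k" using that by simp_all
      then have "\<bar>f (M n k) - f (S n)\<bar> < \<eta>"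
        using K[of "k - Suc n"] by (simp only: dist_real_def)
      then show ?thesis by linarith
    qed
    then show ?thesis by blast
  qed
  have "(\<lambda>n. f (S n)) \<longlonglongrightarrow> f L"
    unfolding L_def using S_anti S_bdd by (intro f_INF_limit antimonoI)
  then have "\<forall>\<^sub>F n in sequentially. dist (f (S n)) (f L) < \<eta>"
    using \<eta>(1) by (rule tendstoD)
  then obtain n where "dist (f (S n)) (f L) < \<eta>"
    by (auto simp: eventually_sequentially)
  then have n: "f (S n) \<le> f L + \<eta>"
    unfolding dist_real_def by linarith
  obtain K1 where K1: "\<And>k. K1 \<le> k \<Longrightarrow> f (S n) \<le> f (M n k) + \<eta>"
    using M_ev by blast
  have "incseq (\<lambda>i. f (v (Suc i)))"
    by (intro incseq_SucI submartingale_f_mono[OF v]) auto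
  then obtain l where "(\<lambda>i. f (v (Suc i))) \<longlonglongrightarrow> l"
    using bounded by (elim incseq_convergent[where B=C]) auto
  then have "Cauchy (\<lambda>i. f (v (Suc i)))"
    by (rule LIMSEQ_imp_Cauchy)
  then obtain K2 where K2': "\<And>i j. K2 \<le> i \<Longrightarrow> K2 \<le> j \<Longrightarrow> dist (f (v (Suc i))) (f (v (Suc j))) < \<eta>"
    using \<eta>(1) unfolding Cauchy_def by blast
  have K2: "f (v j) \<le> f (v i) + \<eta>" if "K2 < i" "K2 < j" for i j
  proof -
    have "dist (f (v i)) (f (v j)) < \<eta>"
      using K2'[of "i - 1" "j - 1"] that by simp
    then show ?thesis unfolding dist_real_def by linarith
  qed
  have "f L \<le> f (u k) + r" if k: "max n (max K1 K2) < k" for k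
  proof -
    have k1: "1 \<le> k" using k by simp
    obtain N where N: "k < N" "f (S k) \<le> f (M k N) + \<eta>"
    proof -
      obtain K where "\<And>N. K \<le> N \<Longrightarrow> f (S k) \<le> f (M k N) + \<eta>"
        using M_ev by blast
      then show thesis by (intro that[of "max (Suc k) K"]) simp_all
    qed
    define Y where "Y = M n k"
    define d where "d = \<delta> *\<^sub>R e"
    \<comment> \<open>The factor \<open>\<kappa>\<close> puts the level \<open>\<kappa> *\<^sub>R d\<close> at \<open>h + h - d\<close>: just \<open>d\<close> below the lower bound \<open>h + h\<close> of \<open>W j\<close> where \<open>u j = Y\<close>.\<close>
    define \<kappa> where "\<kappa> = (2 * c - \<delta>) / \<delta>"
    define W where "W j = E j (v N) - v' j - Y + (h + h)" for j
    have "0 \<le> \<kappa>" using \<delta> c by (simp add: \<kappa>_def)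
    have \<kappa>d: "\<kappa> *\<^sub>R d = h + h - d"
    proof -
      have "\<kappa> * \<delta> = c + c - \<delta>" using \<delta>(1) by (simp add: \<kappa>_def)
      then show ?thesis
        by (simp only: d_def h_def scaleR_scaleR scaleR_add_left scaleR_diff_left)
    qed
    have h_fixed: "E j h = h" and d_fixed: "E j d = d" if "1 \<le> j" for j
      using linear_scale[OF E_linear[OF that], of _ e] E_e[OF that] by (simp_all only: h_def d_def)
    have Y_fixed: "E j Y = Y" if "k \<le> j" for j
    proof (rule E_fixed_mono[OF k1 that])
      have "E k (u i) = u i" if "n < i" "i \<le> k" for i
      proof -
        have "1 \<le> i" using that by simp
        then have "E i (u i) = u i"
          using submartingale_fixed[OF v] submartingale_fixed[OF v'] by (simp add: u E_simps)
        then show ?thesis using E_fixed_mono \<open>1 \<le> i\<close> that by blast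
      qed
      then show "E k Y = Y"
        unfolding Y_def M_def using k by (intro E_fixed_SUP k1) auto
    qed
    have W_lower: "u j - Y + (h + h) \<le> W j" if "k \<le> j" "j \<le> N" for j
      using submartingale_le[OF v, of j N] k1 that
      by (simp add: u W_def diff_right_mono)
    have Y_le: "Y \<le> h" unfolding Y_def using k by (intro M_upper) simp
    obtain T where T: "T \<le> d" "\<kappa> * f T \<le> f (W k)"
      "\<And>j. k \<le> j \<Longrightarrow> j \<le> N \<Longrightarrow> inf (pprt (W j - \<kappa> *\<^sub>R d)) d \<le> T"
    proof (rule maximal_inequality[of k N \<kappa> d W])
      show "0 \<le> d" using \<delta> e_pos by (simp add: d_def scaleR_nonneg_nonneg)
      show "0 \<le> W j" if "k \<le> j" "j \<le> N" for j
      proof -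
        have "- h - h + (h + h) \<le> u j - Y + (h + h)"
          using lower'[of j] Y_le k1 that by (intro add_right_mono diff_mono) auto
        also note W_lower[OF that]
        finally show ?thesis by simp
      qed
      show "E j (W j) = W j" if "k \<le> j" "j \<le> N" for j
        using that k1 submartingale_fixed[OF v', of j] Y_fixed[of j] h_fixed[of j]
        by (simp add: W_def E_simps E_E)
      show "E j (W (Suc j)) \<le> W j" if "k \<le> j" "j < N" for j
        using that k1 submartingale_le[OF v', of j "Suc j"] Y_fixed[of j] h_fixed[of j]
        by (simp add: W_def E_simps E_E diff_right_mono diff_left_mono)
    qed (use k1 N d_fixed \<open>0 \<le> \<kappa>\<close> in auto)
    have "d - T \<le> pprt (Y - u j)" if "k < j" "j \<le> N" for j
    proof -
      let ?g = "W j - \<kappa> *\<^sub>R d"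
      have "d - (Y - u j) = u j - Y + (h + h) - (h + h - d)"
        by (simp add: algebra_simps)
      also have "\<dots> \<le> ?g"
        unfolding \<kappa>d using that by (intro diff_right_mono W_lower) auto
      also have "\<dots> \<le> pprt ?g" by (simp add: pprt_def)
      finally have "d - pprt ?g \<le> Y - u j"
        by (simp only: diff_le_eq add.commute)
      then have "pprt (d - pprt ?g) \<le> pprt (Y - u j)"
        by (rule pprt_mono)
      moreover have "d - T \<le> d - inf (pprt ?g) d"
        using T(3)[of j] that by (intro diff_left_mono) auto
      ultimately show ?thesis
        by (simp only: pprt_diff_eq)
    qed
    then have "d - T \<le> pprt (Y - M k N)"
      unfolding M_def using N(1) by (intro le_pprt_diff_cSUP bdd') auto
    \<comment> \<open>\<open>Y\<close> exceeds \<open>L \<le> S k\<close> by at most \<open>S n - L\<close>.\<close>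
    also have "\<dots> \<le> (S n - L) + (S k - M k N)"
    proof -
      have "Y - M k N = (Y - S k) + (S k - M k N)" by simp
      also have "\<dots> \<le> (S n - L) + (S k - M k N)"
        unfolding Y_def using M_le[of n k] L_le[of k] k by (intro add_right_mono diff_mono) auto
      finally have 1: "Y - M k N \<le> (S n - L) + (S k - M k N)" .
      have "0 \<le> S n - L" "0 \<le> S k - M k N"
        using L_le[of n] M_le[OF N(1)] by (simp_all only: diff_ge_0_iff_ge)
      then have "0 \<le> (S n - L) + (S k - M k N)" by (rule add_nonneg_nonneg)
      with 1 show ?thesis unfolding pprt_def by (rule sup_least)
    qed
    finally have "f (d - T) \<le> f ((S n - L) + (S k - M k N))" by (rule f_mono)
    then have "\<delta> * f e - f T \<le> 2 * \<eta>"
      using n N(2) by (simp only: f_simps d_def) simp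
    then have "\<kappa> * (\<delta> * f e - 2 * \<eta>) \<le> \<kappa> * f T"
      using \<open>0 \<le> \<kappa>\<close> by (intro mult_left_mono) auto
    also have "\<dots> \<le> f (v N) - f (v' k) - f Y + 2 * c * f e"
      using T(2) k1 by (simp add: W_def f_simps f_E h_def)
    also have "\<dots> \<le> f (u k) + \<eta> - f Y + 2 * c * f e"
      using K2[of k N] k N(1) by (simp add: u f_simps)
    finally have *: "\<kappa> * (\<delta> * f e - 2 * \<eta>) \<le> f (u k) + \<eta> - f Y + 2 * c * f e" .
    define t where "t = (2 * c / \<delta>) * (2 * \<eta>)"
    have "\<kappa> * \<delta> = 2 * c - \<delta>" "\<kappa> = 2 * c / \<delta> - 1"
      using \<delta>(1) by (simp add: \<kappa>_def, simp add: \<kappa>_def diff_divide_distrib)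
    then have "\<kappa> * (\<delta> * f e - 2 * \<eta>) = (2 * c - \<delta>) * f e - (2 * c / \<delta> - 1) * (2 * \<eta>)"
      by (metis mult.assoc right_diff_distrib)
    also have "\<dots> = 2 * c * f e - \<delta> * f e - (t - 2 * \<eta>)"
      by (simp only: t_def left_diff_distrib mult_1_left)
    finally have "f Y \<le> f (u k) + \<delta> * f e + t - \<eta>"
      using * by simp
    moreover have "f L \<le> f Y + \<eta>"
      using f_mono[OF L_le[of n]] K1[of k] k unfolding Y_def by auto
    moreover have "2 * \<eta> + t = r / 2"
      using \<eta>(2) unfolding q_def t_def by (simp only: distrib_left mult_1_right mult.commute)
    ultimately show ?thesis
      using \<delta>(3) \<eta>(1) by linarith
  qed
  then show ?thesis
    unfolding L_def S_def by blast
qed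

text \<open>
  The hypotheses are symmetric in \<open>v\<close> and \<open>v'\<close>, so \<open>limsup_f_le\<close> applies to \<open>u\<close> and to \<open>- u\<close>.
  Adding the two estimates shows that \<open>f\<close> does not exceed \<open>0\<close> at the difference of the limits
  superior and inferior of \<open>u\<close>. The elements \<open>D n\<close> are the oscillations of \<open>u\<close> beyond \<open>n\<close>.
\<close>

lemma order_bounded_oscillation:
  assumes v: "submartingale E v" and v': "submartingale E v'"
    and bounded: "\<And>n. 1 \<le> n \<Longrightarrow> f (v n) \<le> C" "\<And>n. 1 \<le> n \<Longrightarrow> f (v' n) \<le> C"
    and u: "\<And>n. u n = v n - v' n"
    and c: "0 < c" and lower: "\<And>n. 1 \<le> n \<Longrightarrow> - (c *\<^sub>R e) \<le> u n"
    and upper: "\<And>n. 1 \<le> n \<Longrightarrow> u n \<le> c *\<^sub>R e"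
  obtains D where "\<And>n i j. n < i \<Longrightarrow> n < j \<Longrightarrow> \<bar>u i - u j\<bar> \<le> D n"
    and "(\<lambda>n. f (D n)) \<longlonglongrightarrow> 0"
proof -
  let ?w = "\<lambda>n. - u n"
  define S where "S u n = (SUP j\<in>{n<..}. u j)" for u :: "nat \<Rightarrow> 'a" and n
  have lower': "- (c *\<^sub>R e) \<le> ?w n" and upper': "?w n \<le> c *\<^sub>R e" if "1 \<le> n" for n
    using lower[OF that] upper[OF that] by (simp_all add: minus_le_iff)
  have w: "?w n = v' n - v n" for n
    by (simp add: u)
  have S_upper: "y j \<le> S y n" if "n < j" "\<And>n. 1 \<le> n \<Longrightarrow> y n \<le> c *\<^sub>R e" for n j y
    unfolding S_def using that by (intro cSUP_upper bdd_aboveI2[of _ _ "c *\<^sub>R e"]) auto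
  have lim: "(\<lambda>n. f (S y n)) \<longlonglongrightarrow> f (INF n. S y n)"
    if "\<And>n. 1 \<le> n \<Longrightarrow> y n \<le> c *\<^sub>R e" "\<And>n. 1 \<le> n \<Longrightarrow> - (c *\<^sub>R e) \<le> y n" for y
  proof (rule f_INF_limit)
    show "decseq (S y)"
      unfolding S_def using that(1)
      by (intro antimonoI cSUP_subset_mono bdd_aboveI2[of _ _ "c *\<^sub>R e"]) auto
    have "- (c *\<^sub>R e) \<le> S y n" for n
      using order_trans[OF that(2) S_upper[of n "Suc n" y, OF _ that(1)]] by simp
    then show "bdd_below (range (S y))"
      by (intro bdd_belowI2)
  qed
  define D where "D n = S u n + S ?w n" for n
  have D: "\<bar>u i - u j\<bar> \<le> D n" if "n < i" "n < j" for n i j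
  proof (rule abs_leI)
    have *: "u i - u j \<le> D n" if "n < i" "n < j" for i j
      using add_mono[OF S_upper[of n i u, OF that(1) upper] S_upper[of n j ?w, OF that(2) upper']]
      by (simp add: D_def)
    from *[OF that] show "u i - u j \<le> D n" .
    from *[OF that(2,1)] show "- (u i - u j) \<le> D n" by simp
  qed
  let ?L = "f (INF n. S u n)" and ?L' = "f (INF n. S ?w n)"
  have "?L + ?L' \<le> 0 + r" if "0 < r" for r
  proof -
    have r: "0 < r / 2" using that by simp
    obtain K where K: "\<And>k. K < k \<Longrightarrow> ?L \<le> f (u k) + r / 2"
      using limsup_f_le[OF v v' bounded(1) u c lower upper r] unfolding S_def by blast
    obtain K' where K': "\<And>k. K' < k \<Longrightarrow> ?L' \<le> f (?w k) + r / 2"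
      using limsup_f_le[where u="?w", OF v' v bounded(2) w c lower' upper' r] unfolding S_def by blast
    have "K < Suc (max K K')" "K' < Suc (max K K')" by simp_all
    from K[OF this(1)] K'[OF this(2)] show ?thesis
      by (simp add: f_simps)
  qed
  then have "?L + ?L' \<le> 0"
    by (rule field_le_epsilon)
  moreover have "(\<lambda>n. f (D n)) \<longlonglongrightarrow> ?L + ?L'"
    unfolding D_def linear_add[OF f_linear]
    by (intro tendsto_add lim lower upper lower' upper')
  moreover have "0 \<le> f (D n)" for n
    using order_trans[OF abs_ge_zero D[of n "Suc n" "Suc n"]] by (intro f_nonneg) simp
  ultimately have "(\<lambda>n. f (D n)) \<longlonglongrightarrow> 0"
    using LIMSEQ_le_const[of "\<lambda>n. f (D n)" "?L + ?L'" 0] by (metis order_antisym)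
  with D show thesis by (rule that)
qed

section \<open>Submartingales bounded under the functional\<close>

text \<open>
  The supermartingale \<open>2 *\<^sub>R E j (pprt (z N)) - z j\<close> dominates \<open>\<bar>z j\<bar> = 2 *\<^sub>R pprt (z j) - z j\<close>, and
  its initial value under \<open>f\<close> is bounded independently of \<open>N\<close>. The maximal inequality therefore
  shows that the parts of \<open>\<bar>z n\<bar>\<close> above level \<open>c\<close> are uniformly small in measure.
\<close>

lemma tail_bound:
  assumes z: "submartingale E z" and bounded: "\<And>n. 1 \<le> n \<Longrightarrow> f (pprt (z n)) \<le> C" and c: "0 < c"
  obtains R where "\<And>n. 1 \<le> n \<Longrightarrow> inf (pprt (\<bar>z n\<bar> - c *\<^sub>R e)) e \<le> R"
    and "c * f R \<le> 2 * C - f (z 1)"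
proof -
  let ?b = "\<lambda>j. inf (pprt (\<bar>z j\<bar> - c *\<^sub>R e)) e"
  have bdd: "bdd_above (?b ` A)" for A
    by (intro bdd_aboveI2[of _ _ e] inf_le2)
  let ?R = "SUP j\<in>{0<..}. ?b j"
  have abs_eq: "\<bar>x\<bar> = 2 *\<^sub>R pprt x - x" for x :: 'a
  proof -
    have "2 *\<^sub>R pprt x - x = pprt x + pprt x - (pprt x + nprt x)"
      by (simp only: scaleR_2 prts[symmetric])
    also have "\<dots> = \<bar>x\<bar>" by (simp only: abs_prts add_diff_cancel_left)
    finally show ?thesis ..
  qed
  have finite: "c * f (SUP j\<in>{0<..N}. ?b j) \<le> 2 * C - f (z 1)" if N: "1 \<le> N" for N
  proof -
    define y where "y = pprt (z N)"
    define W where "W j = 2 *\<^sub>R E j y - z j" for j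
    have W_abs: "\<bar>z j\<bar> \<le> W j" if "1 \<le> j" "j \<le> N" for j
      using submartingale_le[OF submartingale_pprt[OF z] that] that
      unfolding abs_eq W_def y_def by (intro diff_right_mono scaleR_left_mono) auto
    obtain T where T: "T \<le> e" "c * f T \<le> f (W 1)"
      "\<And>j. 1 \<le> j \<Longrightarrow> j \<le> N \<Longrightarrow> inf (pprt (W j - c *\<^sub>R e)) e \<le> T"
    proof (rule maximal_inequality[of 1 N c e W])
      show "0 \<le> W j" if "1 \<le> j" "j \<le> N" for j
        using W_abs[OF that] by (rule order_trans[OF abs_ge_zero])
      show "E j (W j) = W j" if "1 \<le> j" "j \<le> N" for j
        using that submartingale_fixed[OF z] by (simp add: W_def E_simps E_E)
      show "E j (W (Suc j)) \<le> W j" if "1 \<le> j" "j < N" for j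
        using that submartingale_le[OF z, of j "Suc j"]
        by (simp add: W_def E_simps E_E diff_left_mono)
    qed (use N c e_pos E_e in auto)
    have "?b j \<le> T" if "1 \<le> j" "j \<le> N" for j
      using W_abs[OF that] by (intro order_trans[OF _ T(3)[OF that]] inf_mono pprt_mono diff_right_mono) auto
    then have "(SUP j\<in>{0<..N}. ?b j) \<le> T"
      using N by (intro cSUP_least) auto
    then have "c * f (SUP j\<in>{0<..N}. ?b j) \<le> c * f T"
      using c by (intro mult_left_mono f_mono) auto
    also have "\<dots> \<le> f (W 1)" by fact
    also have "\<dots> \<le> 2 * C - f (z 1)"
      using bounded[OF N] by (simp add: W_def f_simps f_E y_def)
    finally show ?thesis .
  qed
  have "(\<lambda>k. c * f (SUP j\<in>{0<..Suc 0 + k}. ?b j)) \<longlonglongrightarrow> c * f ?R"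
    by (intro tendsto_mult_left f_SUP_finite_limit bdd)
  then have "c * f ?R \<le> 2 * C - f (z 1)"
    by (rule LIMSEQ_le_const2) (use finite in auto)
  then show thesis
    by (intro that[of ?R] cSUP_upper bdd) auto
qed

text \<open>
  Strict positivity makes \<open>w\<close> disjoint from the weak unit, and only \<open>0\<close> is.
\<close>

lemma eq_0_if_f_inf_e_le_0:
  assumes "0 \<le> w" "f (inf w e) \<le> 0"
  shows "w = 0"
proof -
  have "inf w e = 0"
    using assms e_pos by (intro f_strict) auto
  then have "inf w (real n *\<^sub>R e) = 0" for n
    using inf_scaleR_eq_0[of e w "real n"] by (simp add: inf_commute)
  then have "isLub UNIV {0} w"
    using weak_unit[OF assms(1)] by (simp add: net_increases_to_def image_constant_conv)
  then have "w \<le> 0"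
    by (auto simp: isLub_def leastP_def setge_def isUb_def setle_def)
  with assms(1) show ?thesis by (rule antisym[rotated])
qed

text \<open>
  The hypothesis on \<open>w\<close> says that \<open>inf w e\<close> lies below every upper bound of the tail
  oscillations of \<open>z\<close>, cut at \<open>e\<close>. Truncating \<open>z\<close> at level \<open>c\<close> splits such an oscillation into
  that of the truncated sequence and two truncation errors. Under \<open>f\<close>, the former tends to \<open>0\<close>, and
  the latter are of order \<open>1 / c\<close>. As \<open>c\<close> is arbitrary, \<open>f (inf w e)\<close> vanishes.
\<close>

lemma vanishing_oscillation:
  assumes z: "submartingale E z" and bounded: "\<And>n. 1 \<le> n \<Longrightarrow> f (pprt (z n)) \<le> C" and "0 \<le> w"
    and w: "\<And>n b. (\<And>i j. n < i \<Longrightarrow> n < j \<Longrightarrow> inf \<bar>z i - z j\<bar> e \<le> b) \<Longrightarrow> inf w e \<le> b"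
  shows "w = 0"
proof -
  define K where "K = 2 * (2 * C - f (z 1))"
  have main: "c * f (inf w e) \<le> K" if c: "0 < c" for c
  proof -
    define h where "h = c *\<^sub>R e"
    define v where "v n = pprt (z n + h)" for n
    define v' where "v' n = pprt (z n + (- h)) + h" for n
    define u where "u n = v n - v' n" for n
    have h: "0 \<le> h" "f h = c * f e" "\<And>n. 1 \<le> n \<Longrightarrow> E n h = h" "\<And>n. 1 \<le> n \<Longrightarrow> E n (- h) = - h"
      using c e_pos by (simp_all add: h_def scaleR_nonneg_nonneg f_simps E_simps E_e)
    have v: "submartingale E v"
      unfolding v_def by (rule submartingale_pprt[OF submartingale_add_fixed[OF z h(3)]])
    have v': "submartingale E v'"
      unfolding v'_def
      by (rule submartingale_add_fixed[OF submartingale_pprt[OF submartingale_add_fixed[OF z h(4)]] h(3)])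
    have f_v: "f (v n) \<le> C + c * f e" if "1 \<le> n" for n
      using f_mono[OF pprt_add_le[of "z n" h]] bounded[OF that] h by (simp add: v_def f_simps)
    have f_v': "f (v' n) \<le> C + c * f e" if "1 \<le> n" for n
      using f_mono[OF pprt_add_le[of "z n" "- h"]] bounded[OF that] h by (simp add: v'_def f_simps)
    have u_eq: "u n = pprt (z n + h) - (pprt (z n - h) + h)" for n
      by (simp add: u_def v_def v'_def)
    have lower: "- (c *\<^sub>R e) \<le> u n" and upper: "u n \<le> c *\<^sub>R e" for n
      unfolding u_eq h_def[symmetric] by (rule clamp_bounds[OF h(1)])+
    obtain D where D: "\<And>n i j. n < i \<Longrightarrow> n < j \<Longrightarrow> \<bar>u i - u j\<bar> \<le> D n"
      and D_lim: "(\<lambda>n. f (D n)) \<longlonglongrightarrow> 0"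
      using order_bounded_oscillation[OF v v' f_v f_v' u_def c lower upper] by blast
    obtain R where R: "\<And>n. 1 \<le> n \<Longrightarrow> inf (pprt (\<bar>z n\<bar> - c *\<^sub>R e)) e \<le> R"
      and f_R: "c * f R \<le> 2 * C - f (z 1)"
      using tail_bound[OF z bounded c] by blast
    have *: "inf \<bar>z i - z j\<bar> e \<le> D n + R + R" if "n < i" "n < j" for n i j
    proof -
      have e: "0 \<le> e" using e_pos by simp
      have zu: "inf \<bar>z i - u i\<bar> e \<le> R" if "n < i" for i
      proof -
        have "\<bar>z i - u i\<bar> \<le> pprt (\<bar>z i\<bar> - c *\<^sub>R e)"
          unfolding u_eq h_def[symmetric] by (rule clamp_bounds[OF h(1)])
        then show ?thesis
          using that by (intro order_trans[OF inf_mono R]) auto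
      qed
      have "\<bar>z i - z j\<bar> = \<bar>(u i - u j) + (z i - u i) + (u j - z j)\<bar>"
        by (simp add: algebra_simps)
      also have "\<dots> \<le> \<bar>u i - u j\<bar> + \<bar>z i - u i\<bar> + \<bar>u j - z j\<bar>"
        by (intro order_trans[OF abs_triangle_ineq] add_right_mono abs_triangle_ineq)
      finally have "inf \<bar>z i - z j\<bar> e \<le> inf (\<bar>u i - u j\<bar> + \<bar>z i - u i\<bar> + \<bar>z j - u j\<bar>) e"
        by (intro inf_mono) (simp_all only: abs_minus_commute[of "u j"] order_refl)
      also have "\<dots> \<le> inf (\<bar>u i - u j\<bar> + \<bar>z i - u i\<bar>) e + inf \<bar>z j - u j\<bar> e"
        by (intro inf_add_le_inf_add_inf add_nonneg_nonneg abs_ge_zero e)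
      also have "\<dots> \<le> (inf \<bar>u i - u j\<bar> e + inf \<bar>z i - u i\<bar> e) + inf \<bar>z j - u j\<bar> e"
        by (intro add_right_mono inf_add_le_inf_add_inf abs_ge_zero e)
      also have "\<dots> \<le> D n + R + R"
        using that by (intro add_mono zu order_trans[OF inf_le1 D])
      finally show ?thesis .
    qed
    have "f (inf w e) \<le> f (D n) + f R + f R" for n
      using f_mono[OF w[OF *]] by (simp only: f_simps)
    moreover have "(\<lambda>n. f (D n) + f R + f R) \<longlonglongrightarrow> 0 + f R + f R"
      by (intro tendsto_intros D_lim)
    ultimately have "f (inf w e) \<le> 0 + f R + f R"
      by (intro LIMSEQ_le_const) auto
    then have "c * f (inf w e) \<le> c * (f R + f R)"
      using c by (intro mult_left_mono) auto
    then show ?thesis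
      using f_R by (simp add: K_def distrib_left)
  qed
  have "f (inf w e) \<le> 0"
  proof (rule ccontr)
    assume "\<not> ?thesis"
    then have pos: "0 < f (inf w e)" by simp
    have "0 < (\<bar>K\<bar> + 1) / f (inf w e)" using pos by (intro divide_pos_pos) auto
    from main[OF this] pos show False by simp
  qed
  with \<open>0 \<le> w\<close> show ?thesis by (rule eq_0_if_f_inf_e_le_0)
qed

text \<open>
  The dominating net is the sequence of suprema \<open>d n\<close> of the tail oscillations cut at \<open>y\<close>. A lower
  bound of all \<open>d n\<close> has vanishing positive part by \<open>vanishing_oscillation\<close>; the infinite
  distributive law passes from the individual oscillations to their supremum.
\<close>

lemma submartingale_uo_Cauchy:
  assumes z: "submartingale E z" and bounded: "\<And>n. 1 \<le> n \<Longrightarrow> f (pprt (z n)) \<le> C"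
  shows "uo_Cauchy z"
  unfolding uo_Cauchy_def uo_converges_def
proof (intro allI impI)
  fix y :: 'a assume y: "0 \<le> y"
  let ?A = "{1..} \<times> {1..} :: (nat \<times> nat) set"
  let ?le = "\<lambda>p q :: nat \<times> nat. fst p \<le> fst q \<and> snd p \<le> snd q"
  let ?g = "\<lambda>p :: nat \<times> nat. inf \<bar>z (fst p) - z (snd p)\<bar> y"
  define d where "d n = (SUP p\<in>{n<..} \<times> {n<..}. ?g p)" for n
  have bdd: "bdd_above (?g ` A)" for A
    by (intro bdd_aboveI2[of _ _ y] inf_le2)
  have g_le: "?g (i, j) \<le> d n" if "n < i" "n < j" for i j n
    unfolding d_def using that by (intro cSUP_upper bdd) auto
  have d_anti: "d m \<le> d n" if "n \<le> m" for m n
  proof -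
    have "(Suc m, Suc m) \<in> {m<..} \<times> {m<..}" by simp
    then show ?thesis
      unfolding d_def using that by (intro cSUP_subset_mono bdd) auto
  qed
  have d_nonneg: "0 \<le> d n" for n
    using g_le[of n "Suc n" "Suc n"] y by (simp add: inf_absorb1)
  have greatest: "l \<le> 0" if l: "\<And>n. l \<le> d n" for l
  proof -
    have "pprt l = 0"
    proof (rule vanishing_oscillation[OF z bounded])
      fix n b assume b: "\<And>i j. n < i \<Longrightarrow> n < j \<Longrightarrow> inf \<bar>z i - z j\<bar> e \<le> b"
      have "pprt l \<le> d n"
        unfolding pprt_def using l d_nonneg by (rule sup_least)
      then have "inf (pprt l) e \<le> inf (d n) e"
        by (rule inf_mono) (rule order_refl)
      also have "\<dots> \<le> b"
        unfolding d_def
      proof (rule inf_cSUP_le[OF _ bdd])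
        show "inf (?g p) e \<le> b" if "p \<in> {n<..} \<times> {n<..}" for p
          using that b[of "fst p" "snd p"] by (intro order_trans[OF inf_mono[OF inf_le1 order_refl]]) auto
        have "(Suc n, Suc n) \<in> {n<..} \<times> {n<..}" by simp
        then show "{n<..} \<times> {n<..} \<noteq> {}" by blast
      qed
      finally show "inf (pprt l) e \<le> b" .
    qed simp_all
    then show ?thesis by (simp only: le_zero_iff_zero_pprt)
  qed
  show "order_converges ?A ?le (\<lambda>p. inf \<bar>(case p of (n, m) \<Rightarrow> z n - z m) - 0\<bar> y) 0"
  proof (rule order_convergesI[where B="UNIV :: nat set" and leB="(\<le>)" and y=d])
    have "\<exists>r\<in>?A. ?le p r \<and> ?le q r" if "p \<in> ?A" "q \<in> ?A" for p q
      using that by (intro bexI[of _ "(max (fst p) (fst q), max (snd p) (snd q))"]) auto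
    then show "directed_index ?A ?le"
      unfolding directed_index_def by (auto simp: reflp_on_def transp_on_def)
    have dir: "directed_index (UNIV :: nat set) (\<le>)"
      by (intro directed_index_linorder) simp
    then show "net_decreases_to UNIV (\<le>) d 0"
      using d_anti d_nonneg greatest
      unfolding net_decreases_to_def isGlb_def greatestP_def isLb_def setge_def setle_def by auto
    fix n :: nat
    show "\<exists>p0\<in>?A. \<forall>p\<in>?A. ?le p0 p \<longrightarrow> \<bar>inf \<bar>(case p of (n, m) \<Rightarrow> z n - z m) - 0\<bar> y - 0\<bar> \<le> d n"
    proof (intro bexI[of _ "(Suc n, Suc n)"] ballI impI)
      fix p assume "?le (Suc n, Suc n) p"
      then have "?g p \<le> d n" using g_le[of n "fst p" "snd p"] by simp
      moreover have "0 \<le> ?g p" using y by simp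
      ultimately show "\<bar>inf \<bar>(case p of (n, m) \<Rightarrow> z n - z m) - 0\<bar> y - 0\<bar> \<le> d n"
        by (simp add: case_prod_beta)
    qed simp
  qed
qed

end

section \<open>Order convergence of order bounded sequences\<close>

text \<open>
  If all \<open>z n\<close> lie in \<open>[a, b]\<close>, then cutting \<open>\<bar>z n - z m\<bar>\<close> at \<open>b - a\<close> changes nothing, and the net that
  dominates these differences also dominates the distance of \<open>z n\<close> to the limit superior.
\<close>

lemma uo_Cauchy_order_bounded_converges:
  fixes z :: "nat \<Rightarrow> 'a::order_complete_vector_lattice"
  assumes "uo_Cauchy z" "bdd_above (z ` {1..})" "bdd_below (z ` {1..})"
  shows "\<exists>x. order_converges {1..} (\<le>) z x"
proof -
  let ?le = "\<lambda>p q :: nat \<times> nat. fst p \<le> fst q \<and> snd p \<le> snd q"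
  obtain a b where a: "\<And>n. 1 \<le> n \<Longrightarrow> a \<le> z n" and b: "\<And>n. 1 \<le> n \<Longrightarrow> z n \<le> b"
    using assms(2,3) by (auto simp: bdd_above_def bdd_below_def)
  have diff: "\<bar>z n - z m\<bar> \<le> b - a" if "1 \<le> n" "1 \<le> m" for n m
  proof (rule abs_leI)
    show "z n - z m \<le> b - a" "- (z n - z m) \<le> b - a"
      using diff_mono[OF b a, of n m] diff_mono[OF b a, of m n] that by simp_all
  qed
  have "0 \<le> b - a"
    using order_trans[OF abs_ge_zero diff[of 1 1]] by simp
  then have "order_converges ({1..} \<times> {1..}) ?le
      (\<lambda>p. inf \<bar>(case p of (n, m) \<Rightarrow> z n - z m) - 0\<bar> (b - a)) 0"
    using assms(1) unfolding uo_Cauchy_def uo_converges_def by blast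
  then obtain B :: "'a set" and leB y where y: "net_decreases_to B leB y 0"
    and dom: "\<And>\<beta>. \<beta> \<in> B \<Longrightarrow> \<exists>p0\<in>{1..} \<times> {1..}. \<forall>p\<in>{1..} \<times> {1..}. ?le p0 p \<longrightarrow>
        \<bar>inf \<bar>(case p of (n, m) \<Rightarrow> z n - z m) - 0\<bar> (b - a) - 0\<bar> \<le> y \<beta>"
    unfolding order_converges_def by blast
  have close: "\<exists>N\<ge>1. \<forall>n\<ge>N. \<forall>m\<ge>N. \<bar>z n - z m\<bar> \<le> y \<beta>" if \<beta>: "\<beta> \<in> B" for \<beta>
  proof -
    obtain p0 where p0: "p0 \<in> {1..} \<times> {1..}" and *: "\<And>p. p \<in> {1..} \<times> {1..} \<Longrightarrow> ?le p0 p \<Longrightarrow>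
        \<bar>inf \<bar>(case p of (n, m) \<Rightarrow> z n - z m) - 0\<bar> (b - a) - 0\<bar> \<le> y \<beta>"
      using dom[OF \<beta>] by blast
    have "\<bar>z n - z m\<bar> \<le> y \<beta>" if "max (fst p0) (snd p0) \<le> n" "max (fst p0) (snd p0) \<le> m" for n m
    proof -
      have "1 \<le> n" "1 \<le> m" using p0 that by auto
      then have "inf \<bar>z n - z m\<bar> (b - a) = \<bar>z n - z m\<bar>"
        by (intro inf_absorb1 diff)
      with *[of "(n, m)"] that \<open>1 \<le> n\<close> \<open>1 \<le> m\<close> show ?thesis by simp
    qed
    moreover have "1 \<le> max (fst p0) (snd p0)" using p0 by auto
    ultimately show ?thesis by blast
  qed
  define S where "S n = (SUP j\<in>{n<..}. z j)" for n
  define x where "x = (INF n. S n)"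
  have S_upper: "z j \<le> S n" if "n < j" for n j
    unfolding S_def using that b by (intro cSUP_upper bdd_aboveI2[of _ _ b]) auto
  have "a \<le> S n" for n
    using a[of "Suc n"] S_upper[of n "Suc n"] by (simp add: order_trans)
  then have S_bdd: "bdd_below (range S)" by (intro bdd_belowI2)
  have "order_converges {1..} (\<le>) z x"
  proof (rule order_convergesI[OF _ y])
    show "directed_index {1::nat..} (\<le>)"
      by (intro directed_index_linorder) auto
    fix \<beta> assume "\<beta> \<in> B"
    then obtain N where N: "1 \<le> N" "\<And>n m. N \<le> n \<Longrightarrow> N \<le> m \<Longrightarrow> \<bar>z n - z m\<bar> \<le> y \<beta>"
      using close by blast
    have "\<bar>z n - x\<bar> \<le> y \<beta>" if n: "N \<le> n" for n
    proof (rule abs_leI)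
      have "z n - y \<beta> \<le> S k" for k
      proof -
        have "z n - z (Suc (max k N)) \<le> y \<beta>"
          using N(2)[OF n, of "Suc (max k N)"] by (simp add: abs_le_iff)
        then have "z n - y \<beta> \<le> z (Suc (max k N))"
          by (simp only: diff_le_eq add.commute)
        also have "\<dots> \<le> S k" by (rule S_upper) simp
        finally show ?thesis .
      qed
      then have "z n - y \<beta> \<le> x"
        unfolding x_def by (intro cINF_greatest) auto
      then show "z n - x \<le> y \<beta>"
        by (simp only: diff_le_eq add.commute)
      have "z j \<le> z n + y \<beta>" if "N < j" for j
        using N(2)[of j n] n that by (simp add: abs_le_iff diff_le_eq add.commute)
      then have "S N \<le> z n + y \<beta>"
        unfolding S_def by (intro cSUP_least) auto
      moreover have "x \<le> S N"
        unfolding x_def by (intro cINF_lower S_bdd) simp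
      ultimately have "x \<le> z n + y \<beta>" by (rule order_trans[rotated])
      then show "- (z n - x) \<le> y \<beta>"
        by (simp only: minus_diff_eq diff_le_eq add.commute)
    qed
    then show "\<exists>n0\<in>{1..}. \<forall>n\<in>{1..}. n0 \<le> n \<longrightarrow> \<bar>z n - x\<bar> \<le> y \<beta>"
      using N(1) by auto
  qed
  then show ?thesis by blast
qed

theorem theorem5p6:
  fixes E :: "nat \<Rightarrow> 'a::order_complete_vector_lattice \<Rightarrow> 'a"
    and x0 :: 'a and x0' :: "'a \<Rightarrow> real" and z :: "nat \<Rightarrow> 'a"
  assumes "abstract_bistochastic E x0 x0'"
    and "submartingale E z"
  shows "(bdd_above ((\<lambda>n. x0' (pprt (z n))) ` {1..}) \<longrightarrow> uo_Cauchy z) \<and>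
    (bdd_above (z ` {1..}) \<and> bdd_below (z ` {1..}) \<longrightarrow>
      (\<exists>x. order_converges {1..} (\<le>) z x))"
proof -
  interpret bistochastic_filtration E x0 x0'
    using assms(1) by unfold_locales
  have Cauchy: "uo_Cauchy z" if bdd: "bdd_above ((\<lambda>n. x0' (pprt (z n))) ` {1..})"
  proof -
    obtain C where "\<And>n. 1 \<le> n \<Longrightarrow> x0' (pprt (z n)) \<le> C"
      using bdd by (auto simp: bdd_above_def)
    then show ?thesis
      by (rule submartingale_uo_Cauchy[OF assms(2)])
  qed
  show ?thesis
  proof (intro conjI impI, erule Cauchy, elim conjE)
    assume above: "bdd_above (z ` {1..})" and below: "bdd_below (z ` {1..})"
    obtain b where "\<And>n. 1 \<le> n \<Longrightarrow> z n \<le> b"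
      using above by (auto simp: bdd_above_def)
    then have "bdd_above ((\<lambda>n. x0' (pprt (z n))) ` {1..})"
      by (intro bdd_aboveI2[of _ _ "x0' (pprt b)"] f_mono pprt_mono) simp
    then show "\<exists>x. order_converges {1..} (\<le>) z x"
      using Cauchy above below by (intro uo_Cauchy_order_bounded_converges)
  qed
qed

end
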